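(* Let $P$ be a fence poset of the form $$z_0<z_1<\dots<z_{u_1}>z_{u_1+1}>\dots>z_{u_1+u_2}<\cdots$$ with $n=u_1+\dots+u_r$ (so the successive maximal monotone runs, alternately ascending and descending and starting with an ascending one, have $u_1,\dots,u_r\ge 1$ cover relations, and the last element is $z_n$). Let $H(m):=\sum_{k=1}^{m}\frac{1}{k+1}$. Then $$i_1(P)\ \ge\ 1+\sum_{k=1}^{r}H(u_k).$$
   Context: A fence poset is a poset whose Hasse diagram is a path, described by the relations between consecutive elements listed from left to right. The order polytope of a finite poset $P$ is $\mathcal{O}(P)=\{f\in[0,1]^P: f(u)\le f(v)\text{ whenever }u\preceq v\}$, and $i_k(P)$ denotes the coefficient of $t^k$ in its Ehrhart polynomial $\mathcal{E}(P;t)$, where $\mathcal{E}(P;t)=\#(t\,\mathcal{O}(P)\cap\mathbb{Z}^P)$ for every positive integer $t$. Thus $i_1(P)$ is the linear coefficient. Equivalently $\mathcal{E}(P;t)=\Omega(P;t+1)$, where $\Omega(P;t)$ is the order polynomial, counting for positive integers $t$ the maps $f:P\to\{1,\dots,t\}$ with $f(x)\le f(y)$ whenever $x\preceq y$. *)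

theory Defs
  imports
    Complex_Main
    "HOL-Library.FuncSet"
    "HOL-Computational_Algebra.Polynomial"
begin

text \<open>
  A poset is a carrier set \<open>P\<close> with a relation \<open>R\<close> such that \<open>partial_order_on P R\<close>;
  \<open>(x, y) \<in> R\<close> reads $x \preceq y$. A vector in $\mathbb{R}^P$ is a function that is
  \<open>undefined\<close> outside \<open>P\<close>, so that sets of such vectors have the right cardinality.
\<close>

definition cover_relation :: "'a rel \<Rightarrow> 'a rel" where
  "cover_relation R =
     {(x, y). (x, y) \<in> R \<and> x \<noteq> y \<and>
        \<not> (\<exists>w. (x, w) \<in> R \<and> (w, y) \<in> R \<and> w \<noteq> x \<and> w \<noteq> y)}"

definition order_polytope :: "'a set \<Rightarrow> 'a rel \<Rightarrow> ('a \<Rightarrow> real) set" where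
  "order_polytope P R =
     {f \<in> P \<rightarrow>\<^sub>E {0..1}. \<forall>u\<in>P. \<forall>v\<in>P. (u, v) \<in> R \<longrightarrow> f u \<le> f v}"

definition dilate_vec :: "'a set \<Rightarrow> nat \<Rightarrow> ('a \<Rightarrow> real) \<Rightarrow> 'a \<Rightarrow> real" where
  "dilate_vec P t f = (\<lambda>x\<in>P. real t * f x)"

definition ehrhart_poly :: "'a set \<Rightarrow> ('a \<Rightarrow> real) set \<Rightarrow> real poly" where
  "ehrhart_poly P S =
     (THE p. \<forall>t::nat. t > 0 \<longrightarrow>
        poly p (real t) = real (card (dilate_vec P t ` S \<inter> (P \<rightarrow>\<^sub>E \<int>))))"

text \<open>The coefficient $i_k(P)$ of $t^k$ in $\mathcal{E}(P;t)$.\<close>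

definition ehrhart_coeff :: "'a set \<Rightarrow> 'a rel \<Rightarrow> nat \<Rightarrow> real" where
  "ehrhart_coeff P R k = coeff (ehrhart_poly P (order_polytope P R)) k"

text \<open>
  The step from \<open>z i\<close> to \<open>z (Suc i)\<close> lies in the \<open>k\<close>-th run, \<open>1 \<le> k \<le> r\<close>, if
  $u_1+\dots+u_{k-1} \le i < u_1+\dots+u_k$.
\<close>

definition in_run :: "nat \<Rightarrow> (nat \<Rightarrow> nat) \<Rightarrow> nat \<Rightarrow> nat \<Rightarrow> bool" where
  "in_run r u k i \<longleftrightarrow> k \<in> {1..r} \<and> (\<Sum>j=1..<k. u j) \<le> i \<and> i < (\<Sum>j=1..k. u j)"

text \<open>
  The Hasse diagram is the path \<open>z 0, \<dots>, z n\<close>; the odd-numbered runs ascend and the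
  even-numbered runs descend.
\<close>

definition fence_poset ::
    "nat \<Rightarrow> (nat \<Rightarrow> nat) \<Rightarrow> (nat \<Rightarrow> 'a) \<Rightarrow> 'a set \<Rightarrow> 'a rel \<Rightarrow> bool" where
  "fence_poset r u z P R \<longleftrightarrow>
     partial_order_on P R \<and>
     bij_betw z {0..(\<Sum>k=1..r. u k)} P \<and>
     cover_relation R =
       {(z i, z (Suc i)) | i k. in_run r u k i \<and> odd k} \<union>
       {(z (Suc i), z i) | i k. in_run r u k i \<and> even k}"

definition H :: "nat \<Rightarrow> real" where
  "H m = (\<Sum>k=1..m. 1 / (real k + 1))"

end

theory Submission
  imports Defs
begin

text \<open>
  The Ehrhart polynomial counts the sequences \<open>x\<^sub>0, \<dots>, x\<^sub>n\<close> in \<open>{0..t}\<close> whose steps ascend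
  or descend weakly as prescribed by a word of booleans (\<open>True\<close> for an ascent). In this count an
  ascent \<open>x \<le> y\<close> is replaced by no condition at all, minus the strict descent \<open>x > y\<close>. Fully
  expanded, every term is a product of numbers of descending chains, and a chain with \<open>w\<close> weak and
  \<open>a\<close> strict descents contributes the polynomial \<open>(t + 1 + w) choose (w + a + 1)\<close>. Its constant
  term is 1 if \<open>a = 0\<close> and 0 otherwise, so a product with several chains contributes to the linear
  coefficient only through one chain at a time. This yields an explicit recursion for the linear
  coefficient \<open>J(s)\<close> of the polynomial of the word \<open>s\<close>.

  A chain without strict descents has linear coefficient \<open>1 + H w\<close>; one with \<open>a + 1\<close> strict
  descents has, up to sign, \<open>\<integral> x\<^sup>w\<^sup>+\<^sup>1 (1 - x)\<^sup>a\<close> over the unit interval, a value of the Beta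
  function. Hence reading an ascent gives \<open>J(True # s) = 1 + J(s) - \<integral> x G\<^sub>s(x)\<close>, where
  \<open>G\<^sub>s = 1\<close> for the empty word, \<open>G\<^sub>s\<close> becomes \<open>x G\<^sub>s\<close> when a descent is put in front of \<open>s\<close> and
  \<open>1 + (1 - x) G\<^sub>s\<close> when an ascent is. From these rules \<open>x G\<^sub>s \<le> 1\<close> pointwise, and if \<open>s\<close> starts
  with exactly \<open>i\<close> ascents even \<open>x G\<^sub>s \<le> 1 - (1 - x)\<^sup>i\<^sup>+\<^sup>1\<close>. The latter makes the \<open>i + 1\<close>-st
  ascent of a run, counted from its right end, raise \<open>J\<close> by at least the \<open>i + 1\<close>-st summand of \<open>H\<close>
  (\<open>lin_coeff_ascending_run\<close>). A descending run of length \<open>q\<close> in front of an ascent raises \<open>J\<close>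
  by \<open>H q\<close> and lowers the subtracted integral (\<open>lin_coeff_descending_run\<close>). Adding the runs one
  at a time from right to left gives the bound.
\<close>

section \<open>Beta numbers\<close>

text \<open>The Beta integral \<open>\<integral> x\<^sup>w (1 - x)\<^sup>a\<close> over the unit interval.\<close>

definition beta :: "nat \<Rightarrow> nat \<Rightarrow> real" where
  "beta w a = fact w * fact a / fact (w + a + 1)"

text \<open>Under the integral sign this is \<open>1 = x + (1 - x)\<close>. Every step below that rearranges
  an integrand is an instance of it.\<close>

lemma beta_pascal: "beta w a = beta (Suc w) a + beta w (Suc a)"
proof -
  have "real w + real a + 2 \<noteq> 0" by linarith
  then show ?thesis
    by (simp add: beta_def divide_simps) (simp add: algebra_simps)
qed

lemma beta_0_right: "beta w 0 = 1 / real (w + 1)"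
  by (simp add: beta_def)

lemma beta_0_left: "beta 0 a = 1 / real (a + 1)"
  by (simp add: beta_def)

lemma beta_nonneg: "beta w a \<ge> 0"
  by (simp add: beta_def)

section \<open>Descending chains\<close>

text \<open>The polynomial \<open>(t + 1 + w) choose (w + a + 1)\<close> in \<open>t\<close>. The recursion in \<open>a\<close> is Pascal's rule;
  choosing it as the definition lets the linear coefficients be read off by the matching
  recursion for the Beta integrals.\<close>

fun chain_poly :: "nat \<Rightarrow> nat \<Rightarrow> real poly" where
  "chain_poly w 0 = (\<Prod>i=1..w+1. [:1, 1 / real i:])"
| "chain_poly w (Suc a) = chain_poly (Suc w) a - chain_poly w a"

lemma poly_chain_poly: "poly (chain_poly w a) (real t) = real ((t + 1 + w) choose (w + a + 1))"
proof (induction w a rule: chain_poly.induct)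
  case (1 w)
  have "poly (chain_poly w 0) (real t) = real ((t + 1 + w) choose (w + 1))"
  proof (induction w)
    case 0
    then show ?case by simp
  next
    case (Suc w)
    have "(w + 2) * ((t + w + 2) choose (w + 2)) = (t + w + 2) * ((t + w + 1) choose (w + 1))"
      using binomial_absorption[of "w + 1" "t + w + 2"] by simp
    then have absorb: "real (w + 2) * real ((t + w + 2) choose (w + 2))
        = real (t + w + 2) * real ((t + w + 1) choose (w + 1))"
      unfolding of_nat_mult [symmetric] by (rule arg_cong)
    have "poly (chain_poly (Suc w) 0) (real t)
        = poly (chain_poly w 0) (real t) * (real (t + w + 2) / real (w + 2))"
      by (simp add: divide_simps) (simp add: algebra_simps)
    also have "poly (chain_poly w 0) (real t) = real ((t + w + 1) choose (w + 1))"
      using Suc by (simp add: ac_simps)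
    also have "\<dots> * (real (t + w + 2) / real (w + 2)) = real ((t + w + 2) choose (w + 2))"
      using absorb by (simp only: times_divide_eq_right divide_eq_eq) (simp add: ac_simps)
    finally show ?case by (simp add: ac_simps)
  qed
  then show ?case by simp
next
  case (2 w a)
  then show ?case by (simp add: algebra_simps)
qed

lemma coeff_chain_poly_0: "coeff (chain_poly w a) 0 = (if a = 0 then 1 else 0)"
  using poly_chain_poly[of w a 0] by (simp add: poly_0_coeff_0 binomial_eq_0)

lemma coeff_1_mult:
  "coeff (p * q) 1 = coeff p 0 * coeff q 1 + coeff p 1 * coeff (q :: real poly) 0"
  by (simp add: coeff_mult atMost_Suc)

lemma coeff_chain_poly_weak: "coeff (chain_poly w 0) 1 = 1 + H w"
proof (induction w)
  case 0
  then show ?case by (simp add: H_def)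
next
  case (Suc w)
  have "chain_poly (Suc w) 0 = chain_poly w 0 * [:1, 1 / real (w + 2):]"
    by simp
  then have "coeff (chain_poly (Suc w) 0) 1 = 1 / real (w + 2) + coeff (chain_poly w 0) 1"
    unfolding coeff_1_mult coeff_chain_poly_0[of w 0]
    by (simp add: coeff_chain_poly_0 del: chain_poly.simps)
  then show ?case using Suc by (simp add: H_def)
qed

text \<open>Pascal's rule for the binomial coefficients turns into \<open>beta_pascal\<close>.\<close>

lemma coeff_chain_poly_strict: "coeff (chain_poly w (Suc a)) 1 = (-1) ^ a * beta (Suc w) a"
proof (induction a arbitrary: w)
  case 0
  have "coeff (chain_poly w (Suc 0)) 1 = H (Suc w) - H w"
    using coeff_chain_poly_weak[of w] coeff_chain_poly_weak[of "Suc w"] by simp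
  then show ?case by (simp add: H_def beta_0_right)
next
  case (Suc a)
  have "coeff (chain_poly w (Suc (Suc a))) 1
      = coeff (chain_poly (Suc w) (Suc a)) 1 - coeff (chain_poly w (Suc a)) 1"
    by (subst chain_poly.simps(2)) (simp only: coeff_diff)
  then show ?case unfolding Suc using beta_pascal[of "Suc w" a] by (simp add: ring_distribs)
qed

section \<open>Turning ascents into strict descents\<close>

text \<open>The counting polynomial for a descending chain with \<open>w\<close> weak and \<open>a\<close> strict descents whose
  last element is followed by steps according to the word. An ascent either cuts the sequence
  after the chain, or is reversed to a strict descent, with a minus sign. The order of the weak
  and strict descents within the chain does not affect the count, so two numbers suffice.\<close>

fun fence_poly :: "nat \<Rightarrow> nat \<Rightarrow> bool list \<Rightarrow> real poly" where
  "fence_poly w a [] = chain_poly w a"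
| "fence_poly w a (False # s) = fence_poly (Suc w) a s"
| "fence_poly w a (True # s) = chain_poly w a * fence_poly 0 0 s - fence_poly w (Suc a) s"

lemma coeff_fence_poly_0: "coeff (fence_poly w a s) 0 = (if a = 0 then 1 else 0)"
  by (induction w a s rule: fence_poly.induct)
    (auto simp: coeff_chain_poly_0 coeff_mult_0)

text \<open>The number of admissible sequences in \<open>{0..t}\<close> that start at \<open>k\<close>.\<close>

fun npaths :: "nat \<Rightarrow> bool list \<Rightarrow> nat \<Rightarrow> nat" where
  "npaths t [] k = 1"
| "npaths t (b # s) k = (\<Sum>j\<in>{j. j \<le> t \<and> (if b then k \<le> j else j \<le> k)}. npaths t s j)"

text \<open>Exchanging the summations pushes a weight on the first element across one step.\<close>

lemma sum_npaths_Cons: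
  "(\<Sum>k\<le>t. g k * real (npaths t (b # s) k))
   = (\<Sum>j\<le>t. (\<Sum>k | k \<le> t \<and> (if b then k \<le> j else j \<le> k). g k) * real (npaths t s j))"
  using sum.swap_restrict[of "{..t}" "{..t}" "\<lambda>k j. g k * real (npaths t s j)"
      "\<lambda>k j. if b then k \<le> j else j \<le> k"]
  by (simp add: sum_distrib_left sum_distrib_right del: if_split)

lemma sum_choose_tail:
  assumes "j \<le> t"
  shows "(\<Sum>k=j..t. (t - k + w) choose (w + a)) = (t - j + Suc w) choose (Suc (w + a))"
  using assms
proof (induction rule: inc_induct)
  case base
  then show ?case by (cases a) (simp_all add: binomial_eq_0)
next
  case (step m)
  then have "Suc (t + w) - m = Suc (t + w - m)" "t + w - m = Suc (t + w - Suc m)" by simp_all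
  then show ?case using step by (simp add: sum.atLeast_Suc_atMost)
qed


text \<open>The weight \<open>(t - k + w) choose (w + a)\<close> is the number of descending chains of the given kind
  in \<open>{0..t}\<close> that end at \<open>k\<close>. Pushing it across a step realises the rules for \<open>fence_poly\<close>.\<close>

lemma sum_npaths_eq_fence_poly:
  "(\<Sum>k\<le>t. real ((t - k + w) choose (w + a)) * real (npaths t s k))
   = poly (fence_poly w a s) (real t)"
proof (induction w a s rule: fence_poly.induct)
  case (1 w a)
  have "(\<Sum>k\<le>t. (t - k + w) choose (w + a)) = (t + Suc w) choose Suc (w + a)"
    using sum_choose_tail[of 0 t w a] by (simp add: atMost_atLeast0)
  then show ?case
    by (simp add: poly_chain_poly flip: of_nat_sum)
next
  case (2 w a s)
  have "(\<Sum>k | k \<le> t \<and> j \<le> k. real ((t - k + w) choose (w + a)))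
      = real ((t - j + Suc w) choose (Suc w + a))" if "j \<le> t" for j
  proof -
    have "{k. k \<le> t \<and> j \<le> k} = {j..t}" by auto
    then show ?thesis using sum_choose_tail[OF that, of w a] by (simp flip: of_nat_sum)
  qed
  then show ?case unfolding sum_npaths_Cons using 2 by simp
next
  case (3 w a s)
  have split: "(\<Sum>k | k \<le> t \<and> k \<le> j. real ((t - k + w) choose (w + a)))
      = real ((t + 1 + w) choose (w + a + 1)) - real ((t - j + w) choose (w + Suc a))"
    if "j \<le> t" for j
  proof -
    let ?g = "\<lambda>k. (t - k + w) choose (w + a)"
    have upto: "{k. k \<le> t \<and> k \<le> j} = {0..j}" using that by auto
    have "sum ?g {0..t} = sum ?g {0..j} + sum ?g {Suc j..t}"
      using sum.ub_add_nat[of 0 j ?g "t - j"] that by simp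
    moreover have "sum ?g {0..t} = (t + 1 + w) choose (w + a + 1)"
      using sum_choose_tail[of 0 t w a] by simp
    moreover have "sum ?g {Suc j..t} = (t - j + w) choose (w + Suc a)"
    proof (cases "j = t")
      case True
      then show ?thesis by (simp add: binomial_eq_0)
    next
      case False
      then show ?thesis using sum_choose_tail[of "Suc j" t w a] that by (simp add: Suc_diff_Suc)
    qed
    ultimately show ?thesis unfolding upto by (simp flip: of_nat_sum)
  qed
  have "(\<Sum>k\<le>t. real ((t - k + w) choose (w + a)) * real (npaths t (True # s) k))
      = (\<Sum>j\<le>t. (real ((t + 1 + w) choose (w + a + 1)) - real ((t - j + w) choose (w + Suc a)))
            * real (npaths t s j))"
    unfolding sum_npaths_Cons by (rule sum.cong) (simp_all only: split atMost_iff if_True)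
  also have "\<dots> = real ((t + 1 + w) choose (w + a + 1)) * (\<Sum>j\<le>t. real (npaths t s j))
      - (\<Sum>j\<le>t. real ((t - j + w) choose (w + Suc a)) * real (npaths t s j))"
    unfolding left_diff_distrib sum_subtractf sum_distrib_left [symmetric] ..
  also have "\<dots> = poly (fence_poly w a (True # s)) (real t)"
    using 3 by (simp add: poly_chain_poly)
  finally show ?case .
qed

section \<open>Counting sequences with prescribed steps\<close>

definition follows :: "('b::linorder) list \<Rightarrow> bool list \<Rightarrow> bool" where
  "follows xs s \<longleftrightarrow> length xs = Suc (length s) \<and>
     (\<forall>i<length s. if s ! i then xs ! i \<le> xs ! Suc i else xs ! Suc i \<le> xs ! i)"

lemma follows_Nil [simp]: "follows (x # xs) [] \<longleftrightarrow> xs = []"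
  by (simp add: follows_def)

lemma follows_Cons [simp]:
  "follows (x # y # ys) (b # s) \<longleftrightarrow> (if b then x \<le> y else y \<le> x) \<and> follows (y # ys) s"
  by (auto simp: follows_def All_less_Suc2)

lemma not_follows_short [simp]: "\<not> follows [] s" "\<not> follows [x] (b # s)"
  by (simp_all add: follows_def)

lemma finite_follows: "finite {xs. set xs \<subseteq> {..t::nat} \<and> follows xs s}"
  by (rule finite_subset[OF _ finite_lists_length_eq[of "{..t}" "Suc (length s)"]])
     (auto simp: follows_def)

lemma card_follows_hd:
  assumes "k \<le> t"
  shows "card {xs. set xs \<subseteq> {..t} \<and> follows xs s \<and> hd xs = k} = npaths t s k"
  using assms
proof (induction s arbitrary: k)
  case Nil
  have "{xs. set xs \<subseteq> {..t} \<and> follows xs [] \<and> hd xs = k} = {[k]}"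
    using Nil by (auto simp: neq_Nil_conv follows_def length_Suc_conv)
  then show ?case by simp
next
  case (Cons b s)
  let ?A = "\<lambda>j. {xs. set xs \<subseteq> {..t} \<and> follows xs s \<and> hd xs = j}"
  let ?J = "{j. j \<le> t \<and> (if b then k \<le> j else j \<le> k)}"
  have "{xs. set xs \<subseteq> {..t} \<and> follows xs (b # s) \<and> hd xs = k} = (#) k ` (\<Union>j\<in>?J. ?A j)"
  proof (intro set_eqI iffI)
    fix xs assume "xs \<in> {xs. set xs \<subseteq> {..t} \<and> follows xs (b # s) \<and> hd xs = k}"
    then have xs: "set xs \<subseteq> {..t}" "follows xs (b # s)" "hd xs = k" by auto
    then obtain y ys where "xs = k # y # ys"
      by (metis list.exhaust list.sel(1) not_follows_short)
    then show "xs \<in> (#) k ` (\<Union>j\<in>?J. ?A j)" using xs by auto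
  next
    fix xs assume "xs \<in> (#) k ` (\<Union>j\<in>?J. ?A j)"
    then obtain j ys where "j \<in> ?J" "ys \<in> ?A j" "xs = k # ys" by blast
    then show "xs \<in> {xs. set xs \<subseteq> {..t} \<and> follows xs (b # s) \<and> hd xs = k}"
      using Cons.prems by (cases ys) auto
  qed
  then have "card {xs. set xs \<subseteq> {..t} \<and> follows xs (b # s) \<and> hd xs = k} = card (\<Union>j\<in>?J. ?A j)"
    by (simp add: card_image)
  also have "\<dots> = (\<Sum>j\<in>?J. card (?A j))"
    by (rule card_UN_disjoint) (auto intro: finite_subset[OF _ finite_follows])
  also have "\<dots> = npaths t (b # s) k"
    unfolding npaths.simps by (rule sum.cong) (simp_all add: Cons.IH)
  finally show ?case .
qed

lemma card_follows:
  "real (card {xs. set xs \<subseteq> {..t} \<and> follows xs s}) = poly (fence_poly 0 0 s) (real t)"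
proof -
  let ?A = "\<lambda>j. {xs. set xs \<subseteq> {..t} \<and> follows xs s \<and> hd xs = j}"
  have "hd xs \<le> t" if "set xs \<subseteq> {..t}" "follows xs s" for xs
    using that by (cases xs) auto
  then have "{xs. set xs \<subseteq> {..t} \<and> follows xs s} = (\<Union>j\<in>{..t}. ?A j)" by auto
  also have "card \<dots> = (\<Sum>j\<le>t. card (?A j))"
    by (rule card_UN_disjoint) (auto intro: finite_subset[OF _ finite_follows])
  also have "\<dots> = (\<Sum>j\<le>t. npaths t s j)"
    by (rule sum.cong) (simp_all add: card_follows_hd)
  finally show ?thesis
    using sum_npaths_eq_fence_poly[of t 0 0 s] by simp
qed

section \<open>The linear coefficient\<close>

text \<open>The integral \<open>\<integral> x\<^sup>w\<^sup>+\<^sup>1 (1 - x)\<^sup>a G\<^sub>s(x)\<close> of the introduction: up to sign, the linear coefficient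
  for a chain that contains \<open>a + 1\<close> strict descents.\<close>

definition chain_defect :: "nat \<Rightarrow> nat \<Rightarrow> bool list \<Rightarrow> real" where
  "chain_defect w a s = (-1) ^ a * coeff (fence_poly w (Suc a) s) 1"

text \<open>The integral forms of \<open>G = 1\<close>, of \<open>x G\<^sub>s\<close> and of \<open>1 + (1 - x) G\<^sub>s\<close>. In the last case the product
  in \<open>fence_poly\<close> contributes only the linear coefficient of the chain, as the constant terms are
  0 for the chain and 1 for the rest.\<close>

lemma chain_defect_simps [simp]:
  "chain_defect w a [] = beta (Suc w) a"
  "chain_defect w a (False # s) = chain_defect (Suc w) a s"
  "chain_defect w a (True # s) = beta (Suc w) a + chain_defect w (Suc a) s"
proof -
  have sign: "(-1) ^ a * ((-1) ^ a * x) = x" for x :: real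
    by (simp flip: power_mult_distrib mult.assoc)
  show "chain_defect w a [] = beta (Suc w) a"
    unfolding chain_defect_def fence_poly.simps coeff_chain_poly_strict by (rule sign)
  show "chain_defect w a (False # s) = chain_defect (Suc w) a s"
    by (simp add: chain_defect_def)
  show "chain_defect w a (True # s) = beta (Suc w) a + chain_defect w (Suc a) s"
    unfolding chain_defect_def fence_poly.simps coeff_diff coeff_1_mult coeff_chain_poly_strict
      coeff_chain_poly_0 coeff_fence_poly_0
    by (simp add: algebra_simps sign del: chain_poly.simps)
qed

lemma beta_Suc_le: "beta (Suc w) a \<le> beta w a"
  using beta_pascal[of w a] beta_nonneg[of w "Suc a"] by simp

lemma beta_antimono: "w \<le> w' \<Longrightarrow> beta w' a \<le> beta w a"
  by (induction rule: dec_induct) (auto intro: order_trans [OF beta_Suc_le])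

lemma chain_defect_antimono: "w \<le> w' \<Longrightarrow> chain_defect w' a s \<le> chain_defect w a s"
proof (induction s arbitrary: w w' a)
  case Nil
  then show ?case by (simp add: beta_antimono)
next
  case (Cons b s)
  then show ?case by (cases b) (simp_all add: add_mono beta_antimono)
qed

text \<open>The integral form of \<open>x G\<^sub>s \<le> 1\<close>.\<close>

lemma chain_defect_le: "chain_defect (Suc w) a s \<le> beta (Suc w) a"
proof (induction s arbitrary: w a)
  case Nil
  then show ?case by (simp add: beta_Suc_le)
next
  case (Cons b s)
  show ?case
  proof (cases b)
    case True
    then show ?thesis using Cons[of w "Suc a"] beta_pascal[of "Suc w" a] by simp
  next
    case False
    then show ?thesis using Cons[of "Suc w" a] beta_Suc_le[of "Suc w" a] by simp
  qed
qed

text \<open>The integral form of \<open>x G \<le> 1 - (1 - x)\<^sup>i\<^sup>+\<^sup>1\<close> for a word with exactly \<open>i\<close> leading ascents. For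
  \<open>i = 0\<close> it says \<open>x G \<le> x\<close>, which holds because the word is empty or starts
  with a descent, that is, because the ascending run ends there.\<close>

lemma chain_defect_ascents_le:
  assumes "s = [] \<or> \<not> hd s"
  shows "chain_defect w a (replicate i True @ s) \<le> beta w a - beta w (a + i + 1)"
proof (induction i arbitrary: a)
  case 0
  have "chain_defect w a s \<le> beta (Suc w) a"
    using assms chain_defect_le by (cases s) auto
  then show ?case using beta_pascal[of w a] by simp
next
  case (Suc i)
  show ?case using Suc[of "Suc a"] beta_pascal[of w a] by simp
qed

definition lin_coeff :: "bool list \<Rightarrow> real" where
  "lin_coeff s = coeff (fence_poly 0 0 s) 1"

lemma coeff_fence_poly_ascent:
  "coeff (fence_poly w 0 (True # s)) 1 = 1 + H w + lin_coeff s - chain_defect w 0 s"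
  unfolding fence_poly.simps coeff_diff coeff_1_mult coeff_chain_poly_weak coeff_chain_poly_0
    coeff_fence_poly_0 lin_coeff_def chain_defect_def by simp

lemma H_0 [simp]: "H 0 = 0" and H_Suc: "H (Suc m) = H m + 1 / (real m + 2)"
  by (simp_all add: H_def add.commute)

lemma lin_coeff_Nil: "lin_coeff [] = 1"
  using coeff_chain_poly_weak[of 0] by (simp add: lin_coeff_def)

text \<open>An ascent in front of \<open>p\<close> others adds \<open>1 - \<integral> x G \<ge> \<integral> (1 - x)\<^sup>p\<^sup>+\<^sup>1 = 1 / (p + 2)\<close>.\<close>

lemma lin_coeff_ascending_run:
  assumes "s = [] \<or> \<not> hd s"
  shows "lin_coeff (replicate p True @ s) \<ge> H p + lin_coeff s"
proof (induction p)
  case 0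
  then show ?case by simp
next
  case (Suc p)
  have "chain_defect 0 0 (replicate p True @ s) \<le> 1 - 1 / (real p + 2)"
    using chain_defect_ascents_le[OF assms, of 0 0 p] by (simp add: beta_0_left add.commute)
  then show ?case
    using Suc coeff_fence_poly_ascent[of 0 "replicate p True @ s"] by (simp add: lin_coeff_def H_Suc)
qed

lemma fence_poly_descents: "fence_poly w a (replicate q False @ s) = fence_poly (w + q) a s"
  by (induction q arbitrary: w) simp_all

text \<open>The run changes the leading chain from one element to a chain with \<open>q\<close> weak descents. This adds
  \<open>H q\<close> exactly, and if an ascent follows it can only shrink the subtracted integral, whose factor \<open>x\<close> turns into
  \<open>x\<^sup>q\<^sup>+\<^sup>1\<close>.\<close>

lemma lin_coeff_descending_run:
  assumes "s = [] \<or> hd s"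
  shows "lin_coeff (replicate q False @ s) \<ge> H q + lin_coeff s"
proof (cases s)
  case Nil
  have "lin_coeff (replicate q False @ s) = coeff (chain_poly q 0) 1"
    using fence_poly_descents[of 0 0 q s] Nil by (simp add: lin_coeff_def del: chain_poly.simps)
  then show ?thesis using Nil by (simp only: lin_coeff_Nil coeff_chain_poly_weak)
next
  case (Cons b s')
  then have s: "s = True # s'" using assms by simp
  have "chain_defect q 0 s' \<le> chain_defect 0 0 s'"
    by (rule chain_defect_antimono) simp
  then show ?thesis
    using coeff_fence_poly_ascent[of q s'] coeff_fence_poly_ascent[of 0 s']
      fence_poly_descents[of 0 0 q s] by (simp add: s lin_coeff_def)
qed

text \<open>The step word of the runs \<open>m, \<dots>, m' - 1\<close>. The lower end is a parameter because the bound is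
  proved from right to left, whereas the position of a step counts from the left.\<close>

definition runs_word :: "(nat \<Rightarrow> nat) \<Rightarrow> nat \<Rightarrow> nat \<Rightarrow> bool list" where
  "runs_word u m m' = concat (map (\<lambda>k. replicate (u k) (odd k)) [m..<m'])"

lemma lin_coeff_runs_word:
  assumes "\<And>k. k \<in> {1..r} \<Longrightarrow> u k \<ge> 1" and "1 \<le> m" and "m \<le> Suc r"
  shows "lin_coeff (runs_word u m (Suc r)) \<ge> 1 + (\<Sum>k=m..r. H (u k))"
  using assms(3,2)
proof (induction rule: inc_induct)
  case base
  then show ?case by (simp add: runs_word_def lin_coeff_Nil)
next
  case (step m)
  let ?s = "runs_word u (Suc m) (Suc r)"
  have word: "runs_word u m (Suc r) = replicate (u m) (odd m) @ ?s"
    using step by (simp add: runs_word_def upt_conv_Cons del: upt_Suc)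
  \<comment> \<open>Runs are nonempty, so consecutive runs cannot merge and the two run lemmas apply.\<close>
  have "?s = [] \<or> hd ?s = even m"
  proof (cases "m = r")
    case True
    then show ?thesis by (simp add: runs_word_def)
  next
    case False
    then have "u (Suc m) \<ge> 1" using assms(1) step by simp
    moreover have "?s = replicate (u (Suc m)) (even m) @ runs_word u (Suc (Suc m)) (Suc r)"
      using step False by (simp add: runs_word_def upt_conv_Cons del: upt_Suc)
    ultimately show ?thesis by (cases "u (Suc m)") simp_all
  qed
  then have "lin_coeff (runs_word u m (Suc r)) \<ge> H (u m) + lin_coeff ?s"
    unfolding word
    using lin_coeff_ascending_run[of ?s "u m"] lin_coeff_descending_run[of ?s "u m"]
    by (cases "odd m") auto
  moreover have "(\<Sum>k=m..r. H (u k)) = H (u m) + (\<Sum>k=Suc m..r. H (u k))"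
    using step by (simp add: sum.atLeast_Suc_atMost)
  ultimately show ?case using step by simp
qed


section \<open>Lattice points of the dilated order polytope\<close>

text \<open>A relation that is not a cover splits at an intermediate element into two relations with
  smaller intervals.\<close>

lemma partial_order_rtrancl_cover:
  assumes "partial_order_on P R" and "finite P" and "(x, y) \<in> R"
  shows "(x, y) \<in> (cover_relation R)\<^sup>*"
  using assms(3)
proof (induction "card {w. (x, w) \<in> R \<and> (w, y) \<in> R}" arbitrary: x y rule: less_induct)
  case less
  have sub: "R \<subseteq> P \<times> P" and refl: "refl_on P R" and "trans R" "antisym R"
    using assms(1) unfolding partial_order_on_def preorder_on_def by auto
  have fin: "finite {w. (x, w) \<in> R \<and> (w, y) \<in> R}"
    by (rule finite_subset[OF _ assms(2)]) (use sub in auto)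
  show ?case
  proof (cases "x = y \<or> (x, y) \<in> cover_relation R")
    case True
    then show ?thesis by auto
  next
    case False
    then obtain w where w: "(x, w) \<in> R" "(w, y) \<in> R" "w \<noteq> x" "w \<noteq> y"
      using less.prems unfolding cover_relation_def by auto
    have "(x, x) \<in> R" "(y, y) \<in> R" using refl sub less.prems by (auto simp: refl_on_def)
    have "y \<notin> {v. (x, v) \<in> R \<and> (v, w) \<in> R}" "x \<notin> {v. (w, v) \<in> R \<and> (v, y) \<in> R}"
      using w \<open>antisym R\<close> by (auto dest: antisymD)
    then have "{v. (x, v) \<in> R \<and> (v, w) \<in> R} \<subset> {v. (x, v) \<in> R \<and> (v, y) \<in> R}"
      and "{v. (w, v) \<in> R \<and> (v, y) \<in> R} \<subset> {v. (x, v) \<in> R \<and> (v, y) \<in> R}"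
      using w less.prems \<open>(x, x) \<in> R\<close> \<open>(y, y) \<in> R\<close> \<open>trans R\<close> by (auto dest: transD)
    then have "(x, w) \<in> (cover_relation R)\<^sup>*" "(w, y) \<in> (cover_relation R)\<^sup>*"
      using less.hyps w fin by (simp_all add: psubset_card_mono)
    then show ?thesis by (rule rtrancl_trans)
  qed
qed

lemma monotone_iff_covers:
  fixes f :: "'a \<Rightarrow> 'b::preorder"
  assumes "partial_order_on P R" and "finite P"
  shows "(\<forall>x\<in>P. \<forall>y\<in>P. (x, y) \<in> R \<longrightarrow> f x \<le> f y) \<longleftrightarrow> (\<forall>(x, y)\<in>cover_relation R. f x \<le> f y)"
proof
  have sub: "R \<subseteq> P \<times> P"
    using assms(1) unfolding partial_order_on_def preorder_on_def by auto
  assume "\<forall>x\<in>P. \<forall>y\<in>P. (x, y) \<in> R \<longrightarrow> f x \<le> f y"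
  then show "\<forall>(x, y)\<in>cover_relation R. f x \<le> f y"
    using sub unfolding cover_relation_def by auto
next
  assume covers: "\<forall>(x, y)\<in>cover_relation R. f x \<le> f y"
  have "f x \<le> f y" if "(x, y) \<in> (cover_relation R)\<^sup>*" for x y
    using that by induction (use covers in \<open>auto intro: order_trans\<close>)
  then show "\<forall>x\<in>P. \<forall>y\<in>P. (x, y) \<in> R \<longrightarrow> f x \<le> f y"
    using partial_order_rtrancl_cover[OF assms] by blast
qed

lemma runs_word_Suc:
  "runs_word u 1 (Suc (Suc r)) = runs_word u 1 (Suc r) @ replicate (u (Suc r)) (odd (Suc r))"
  by (simp add: runs_word_def)

lemma length_runs_word: "length (runs_word u 1 (Suc r)) = (\<Sum>k=1..r. u k)"
proof (induction r)
  case 0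
  then show ?case by (simp add: runs_word_def)
next
  case (Suc r)
  then show ?case unfolding runs_word_Suc by simp
qed

lemma in_run_Suc:
  "in_run (Suc r) u k i \<longleftrightarrow>
     in_run r u k i \<or> k = Suc r \<and> (\<Sum>j=1..r. u j) \<le> i \<and> i < (\<Sum>j=1..Suc r. u j)"
  unfolding in_run_def by (auto simp: le_Suc_eq atLeastLessThanSuc_atLeastAtMost)

lemma in_run_less: "in_run r u k i \<Longrightarrow> i < (\<Sum>j=1..r. u j)"
  unfolding in_run_def
  by (meson atLeastAtMost_iff less_le_trans sum_mono2 finite_atLeastAtMost
      atLeastatMost_subset_iff order_refl zero_le)

lemma nth_runs_word: "in_run r u k i \<Longrightarrow> runs_word u 1 (Suc r) ! i = odd k"
proof (induction r)
  case 0
  then show ?case by (simp add: in_run_def)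
next
  case (Suc r)
  from Suc.prems show ?case
    unfolding runs_word_Suc in_run_Suc
    using Suc.IH in_run_less[of r u k i]
    by (auto simp: nth_append length_runs_word simp del: One_nat_def)
qed

lemma ex_in_run: "i < (\<Sum>j=1..r. u j) \<Longrightarrow> \<exists>k. in_run r u k i"
proof (induction r)
  case 0
  then show ?case by simp
next
  case (Suc r)
  then show ?case unfolding in_run_Suc by (cases "i < (\<Sum>j=1..r. u j)") auto
qed


lemma dilate_order_polytope:
  assumes "t > 0"
  shows "dilate_vec P t ` order_polytope P R
    = {g \<in> P \<rightarrow>\<^sub>E {0..real t}. \<forall>x\<in>P. \<forall>y\<in>P. (x, y) \<in> R \<longrightarrow> g x \<le> g y}"
proof (intro set_eqI iffI)
  fix g assume "g \<in> dilate_vec P t ` order_polytope P R"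
  then obtain f where f: "f \<in> order_polytope P R" "g = dilate_vec P t f" by blast
  have "f x \<in> {0..1}" if "x \<in> P" for x
    using f(1) that unfolding order_polytope_def by (auto simp: PiE_iff)
  then have "0 \<le> real t * f x \<and> real t * f x \<le> real t" if "x \<in> P" for x
    using that by (force intro: mult_left_le)
  then show "g \<in> {g \<in> P \<rightarrow>\<^sub>E {0..real t}. \<forall>x\<in>P. \<forall>y\<in>P. (x, y) \<in> R \<longrightarrow> g x \<le> g y}"
    using f unfolding order_polytope_def dilate_vec_def by (auto intro!: mult_left_mono)
next
  fix g assume g: "g \<in> {g \<in> P \<rightarrow>\<^sub>E {0..real t}. \<forall>x\<in>P. \<forall>y\<in>P. (x, y) \<in> R \<longrightarrow> g x \<le> g y}"
  define f where "f = (\<lambda>x\<in>P. g x / real t)"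
  have "g x \<in> {0..real t}" if "x \<in> P" for x
    using g that by (auto simp: PiE_iff)
  then have "f \<in> order_polytope P R"
    using g assms unfolding order_polytope_def f_def by (auto intro!: divide_right_mono)
  moreover have "g = dilate_vec P t f"
    using g assms by (auto simp: dilate_vec_def f_def PiE_iff extensional_def)
  ultimately show "g \<in> dilate_vec P t ` order_polytope P R" by blast
qed

lemma follows_map_real: "follows (map real xs) s \<longleftrightarrow> follows xs s"
  by (auto simp: follows_def split: if_splits)

lemma follows_iff_covers:
  fixes g :: "'a \<Rightarrow> 'b::linorder"
  assumes "fence_poset r u z P R"
  shows "follows (map (\<lambda>i. g (z i)) [0..<Suc (\<Sum>k=1..r. u k)]) (runs_word u 1 (Suc r)) \<longleftrightarrow>
    (\<forall>(x, y)\<in>cover_relation R. g x \<le> g y)" (is "follows ?gs ?s \<longleftrightarrow> ?covers")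
proof -
  let ?n = "\<Sum>k=1..r. u k"
  have "?gs ! i = g (z i)" if "i \<le> ?n" for i
    using that nth_map[of i "[0..<Suc ?n]" "\<lambda>i. g (z i)"] nth_upt[of 0 i "Suc ?n"]
    by (simp del: upt_Suc)
  then have "follows ?gs ?s \<longleftrightarrow>
      (\<forall>i<?n. if ?s ! i then g (z i) \<le> g (z (Suc i)) else g (z (Suc i)) \<le> g (z i))"
    unfolding follows_def length_runs_word by (simp del: upt_Suc)
  also have "\<dots> \<longleftrightarrow> (\<forall>i k. in_run r u k i \<longrightarrow>
      (if odd k then g (z i) \<le> g (z (Suc i)) else g (z (Suc i)) \<le> g (z i)))" (is "?L \<longleftrightarrow> ?M")
  proof
    assume ?L
    then show ?M using in_run_less[of r u] nth_runs_word[of r u] by simp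
  next
    assume M: ?M
    show ?L
    proof (intro allI impI)
      fix i assume "i < ?n"
      then obtain k where "in_run r u k i" using ex_in_run by blast
      then show "if ?s ! i then g (z i) \<le> g (z (Suc i)) else g (z (Suc i)) \<le> g (z i)"
        using M nth_runs_word[of r u k i] by simp
    qed
  qed
  also have "\<dots> \<longleftrightarrow> ?covers"
  proof -
    have covers: "cover_relation R = {(z i, z (Suc i)) | i k. in_run r u k i \<and> odd k} \<union>
        {(z (Suc i), z i) | i k. in_run r u k i \<and> even k}"
      using assms unfolding fence_poset_def by blast
    show ?thesis
    proof
      assume ?M
      then show ?covers unfolding covers by (auto split: if_splits)
    next
      assume mono: ?covers
      show ?M
      proof (intro allI impI)
        fix i k assume "in_run r u k i"
        then have "if odd k then (z i, z (Suc i)) \<in> cover_relation R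
            else (z (Suc i), z i) \<in> cover_relation R"
          unfolding covers by auto
        then show "if odd k then g (z i) \<le> g (z (Suc i)) else g (z (Suc i)) \<le> g (z i)"
          using mono by (auto split: if_splits)
      qed
    qed
  qed
  finally show ?thesis .
qed

text \<open>Reading a lattice point along the path \<open>z 0, \<dots>, z n\<close> gives a sequence of naturals; monotonicity
  is determined by the covers, and these are the steps of the path.\<close>

lemma card_lattice_points:
  assumes fence: "fence_poset r u z P R" and "t > 0"
  shows "card (dilate_vec P t ` order_polytope P R \<inter> (P \<rightarrow>\<^sub>E \<int>))
    = card {xs. set xs \<subseteq> {..t} \<and> follows xs (runs_word u 1 (Suc r))}"
    (is "card ?A = card ?B")
proof -
  define n where "n = (\<Sum>k=1..r. u k)"
  let ?s = "runs_word u 1 (Suc r)"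
  have bij: "bij_betw z {0..n} P" and order: "partial_order_on P R"
    using fence by (auto simp: fence_poset_def n_def)
  then have "finite P" using bij_betw_finite by blast
  have A: "g \<in> ?A \<longleftrightarrow> g \<in> P \<rightarrow>\<^sub>E {0..real t} \<inter> \<int> \<and> follows (map (\<lambda>i. g (z i)) [0..<Suc n]) ?s" for g
    unfolding dilate_order_polytope[OF \<open>t > 0\<close>] n_def follows_iff_covers[OF fence]
      monotone_iff_covers[OF order \<open>finite P\<close>]
    by (auto simp: PiE_iff)
  have len: "length xs = Suc n" if "xs \<in> ?B" for xs
    using that by (simp add: follows_def length_runs_word n_def del: One_nat_def)
  define ix where "ix = inv_into {0..n} z"
  have ix: "ix (z i) = i" "z i \<in> P" if "i \<le> n" for i
    using that bij by (auto simp: ix_def bij_betw_def)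
  have ix': "z (ix x) = x" "ix x \<le> n" if "x \<in> P" for x
    using that bij inv_into_into[of x z "{0..n}"]
    by (auto simp: ix_def bij_betw_def f_inv_into_f)
  define h where "h = (\<lambda>g :: 'a \<Rightarrow> real. map (\<lambda>i. nat \<lfloor>g (z i)\<rfloor>) [0..<Suc n])"
  define h' where "h' = (\<lambda>xs. \<lambda>x\<in>P. real (xs ! ix x))"
  have real_h: "map real (h g) = map (\<lambda>i. g (z i)) [0..<Suc n]" if "g \<in> ?A" for g
  proof -
    have "real (nat \<lfloor>g (z i)\<rfloor>) = g (z i)" if "i \<le> n" for i
      using \<open>g \<in> ?A\<close> ix(2)[OF that] unfolding A by (auto simp: PiE_iff elim!: Ints_cases)
    then show ?thesis by (simp add: h_def del: upt_Suc)
  qed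
  have h'_z: "map (\<lambda>i. h' xs (z i)) [0..<Suc n] = map real xs" if "xs \<in> ?B" for xs
    by (rule nth_equalityI) (use len[OF that] ix in \<open>auto simp: h'_def simp del: upt_Suc\<close>)
  have "bij_betw h ?A ?B"
  proof (rule bij_betw_byWitness[where f' = h'])
    show "\<forall>g\<in>?A. h' (h g) = g"
    proof
      fix g assume g: "g \<in> ?A"
      have "h' (h g) x = g x" for x
      proof (cases "x \<in> P")
        case True
        have "real (h g ! ix x) = map real (h g) ! ix x"
          using ix'[OF True] by (simp add: h_def del: upt_Suc)
        then show ?thesis
          using True ix'[OF True] unfolding real_h[OF g] by (simp add: h'_def del: upt_Suc)
      next
        case False
        then show ?thesis using g unfolding A by (auto simp: h'_def PiE_iff extensional_def)
      qed
      then show "h' (h g) = g" by blast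
    qed
    show "\<forall>xs\<in>?B. h (h' xs) = xs"
    proof
      fix xs assume xs: "xs \<in> ?B"
      have "h (h' xs) = map (nat \<circ> floor) (map (\<lambda>i. h' xs (z i)) [0..<Suc n])"
        by (simp add: h_def del: upt_Suc)
      also have "\<dots> = xs" unfolding h'_z[OF xs] by (simp add: o_def)
      finally show "h (h' xs) = xs" .
    qed
    show "h ` ?A \<subseteq> ?B"
    proof
      fix xs assume "xs \<in> h ` ?A"
      then obtain g where g: "g \<in> ?A" "xs = h g" by blast
      have "follows xs ?s"
        using g(1) real_h[OF g(1)] follows_map_real[of xs ?s] unfolding A g(2) by simp
      moreover have "nat \<lfloor>g (z i)\<rfloor> \<le> t" if "i \<le> n" for i
        using g(1) ix(2)[OF that] unfolding A by (auto simp: PiE_iff floor_le_iff nat_le_iff)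
      then have "set xs \<subseteq> {..t}" unfolding g(2) h_def by (auto simp del: upt_Suc)
      ultimately show "xs \<in> ?B" by blast
    qed
    show "h' ` ?B \<subseteq> ?A"
    proof
      fix g assume "g \<in> h' ` ?B"
      then obtain xs where xs: "xs \<in> ?B" "g = h' xs" by blast
      have "xs ! ix x \<le> t" if "x \<in> P" for x
      proof -
        have "xs ! ix x \<in> set xs" using len[OF xs(1)] ix'(2)[OF that] by simp
        then show ?thesis using xs(1) by blast
      qed
      then have "g \<in> P \<rightarrow>\<^sub>E {0..real t} \<inter> \<int>" unfolding xs(2) h'_def by auto
      then show "g \<in> ?A"
        using xs(1) unfolding A xs(2) h'_z[OF xs(1)] follows_map_real by blast
    qed
  qed
  then show ?thesis by (rule bij_betw_same_card)
qed

lemma poly_eq_if_eq_at_pos_nats: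
  fixes p q :: "real poly"
  assumes "\<And>t::nat. t > 0 \<Longrightarrow> poly p (real t) = poly q (real t)"
  shows "p = q"
proof (rule ccontr)
  assume "p \<noteq> q"
  then have "finite {x. poly (p - q) x = 0}" by (intro poly_roots_finite) simp
  then have "finite (real ` {0<..})"
    by (rule rev_finite_subset) (use assms in auto)
  then show False by (auto dest: finite_imageD simp: infinite_Ioi)
qed

lemma ehrhart_poly_fence:
  assumes "fence_poset r u z P R"
  shows "ehrhart_poly P (order_polytope P R) = fence_poly 0 0 (runs_word u 1 (Suc r))"
  unfolding ehrhart_poly_def
  by (rule the_equality)
     (auto simp: card_lattice_points[OF assms] card_follows intro!: poly_eq_if_eq_at_pos_nats)

theorem theorem5p3:
  fixes P :: "'a set" and R :: "'a rel" and z :: "nat \<Rightarrow> 'a"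
    and r :: nat and u :: "nat \<Rightarrow> nat"
  assumes "\<And>k. k \<in> {1..r} \<Longrightarrow> u k \<ge> 1"
    and "fence_poset r u z P R"
  shows "ehrhart_coeff P R 1 \<ge> 1 + (\<Sum>k=1..r. H (u k))"
  using lin_coeff_runs_word[of r u 1] assms
  unfolding ehrhart_coeff_def ehrhart_poly_fence[OF assms(2)] lin_coeff_def by simp

end
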